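(* Let $\Omega$ and $\Omega'$ be aperiodic, minimal tiling spaces of $\mathbb{R}^d$ with finite local complexity, and let $h:\Omega\to\Omega'$ be a homeomorphism. For $T\in\Omega$ let $h_T:\mathbb{R}^d\to\mathbb{R}^d$ be the function defined by $h(T-x)=h(T)-h_T(x)$. Then the function $$\Omega\times\mathbb{R}^d\to\mathbb{R}^d,\qquad (T,x)\mapsto h_T(x)$$ is continuous in two variables (jointly continuous). Furthermore, for any fixed $T\in\Omega$, $h_T$ is a homeomorphism, and $$(h_T)^{-1}=(h^{-1})_{h(T)}.$$
   Context: Tilings. A tile is a compact subset of $\mathbb{R}^d$ homeomorphic to a closed ball and equal to the closure of its interior (possibly decorated with a label); a prototile is an equivalence class of tiles under translation. For each tiling space a finite collection of prototiles is fixed. A tiling is a collection $T=\{t_i\}_{i\in I}$ of tiles whose translation classes are in this collection, whose union is $\mathbb{R}^d$, and such that $t_i\cap t_j$ has empty interior for $i\neq j$. For $x\in\mathbb{R}^d$, $T-x=\{t_i-x\}_{i\in I}$ (tilings are not identified with their translates). $B(x,r)$ is the ball of centre $x$ and radius $r$, and $T\cap B(x,r)$ denotes the patch of all tiles of $T$ which intersect $B(x,r)$. $T$ is aperiodic if $T-x\neq T$ for all $x\neq 0$; $T$ has finite local complexity (FLC) if for all $R>0$ there are finitely many patches $T\cap B(x,R)$, $x\in\mathbb{R}^d$, up to translation; $T$ is repetitive if for every finite patch $P\subset T$ there is $R>0$ such that a translate of $P$ appears in $T\cap B(x,R)$ for every $x\in\mathbb{R}^d$. Tiling spaces. Define a distance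 on tilings with the given prototiles by letting $D(T_1,T_2)$ be the minimum of $1/\sqrt2$ and the infimum of all $\varepsilon>0$ for which there are $x_1,x_2\in\mathbb{R}^d$ with $\|x_i\|\le\varepsilon$ such that $T_1-x_1$ and $T_2-x_2$ agree on $B(0,1/\varepsilon)$. The hull (tiling space) of $T$ is the closure $\Omega=\overline{\{T-x : x\in\mathbb{R}^d\}}$ for $D$; $\mathbb{R}^d$ acts continuously on it by translation. An aperiodic minimal FLC tiling space is the hull of an aperiodic, repetitive tiling with FLC (repetitivity corresponds to minimality of the translation action). The functions $h_T$. In such tiling spaces the path-connected components are the $\mathbb{R}^d$-orbits, so a homeomorphism sends orbits to orbits; by aperiodicity, for each $T$ and $x$ there is exactly one vector $h_T(x)$ with $h(T-x)=h(T)-h_T(x)$. The maps $(h^{-1})_{T'}$, $T'\in\Omega'$, are defined in the same way from $h^{-1}:\Omega'\to\Omega$. *)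

theory Defs
  imports "HOL-Analysis.Analysis"
begin

text \<open>A tile carries a label; undecorated tiles are the case of a one-element label type.\<close>

type_synonym ('n, 'l) tile = "(real ^ 'n) set \<times> 'l"

type_synonym ('n, 'l) tiling = "('n, 'l) tile set"

definition is_tile :: "('n::finite, 'l) tile \<Rightarrow> bool" where
  "is_tile t \<longleftrightarrow>
     compact (fst t) \<and>
     fst t homeomorphic (cball 0 1 :: (real ^ 'n) set) \<and>
     closure (interior (fst t)) = fst t"

definition shift_tile :: "('n::finite, 'l) tile \<Rightarrow> real ^ 'n \<Rightarrow> ('n, 'l) tile" where
  "shift_tile t x = ((\<lambda>y. y - x) ` fst t, snd t)"

definition shift :: "('n::finite, 'l) tile set \<Rightarrow> real ^ 'n \<Rightarrow> ('n, 'l) tile set"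
    (infixl \<open>\<ominus>\<close> 65) where
  "T \<ominus> x = (\<lambda>t. shift_tile t x) ` T"

definition tile_class :: "('n::finite, 'l) tile \<Rightarrow> ('n, 'l) tile set" where
  "tile_class t = range (shift_tile t)"

definition prototile :: "('n::finite, 'l) tile set \<Rightarrow> bool" where
  "prototile p \<longleftrightarrow> (\<exists>t. is_tile t \<and> p = tile_class t)"

text \<open>Tilings are sets rather than indexed families of tiles: since a tile has nonempty interior,
  the overlap condition forces distinct indices to carry distinct tiles.\<close>

definition tilings :: "('n::finite, 'l) tile set set \<Rightarrow> ('n, 'l) tiling set" where
  "tilings P = {T.
     (\<forall>t\<in>T. is_tile t \<and> tile_class t \<in> P) \<and>
     (\<Union>t\<in>T. fst t) = UNIV \<and>
     (\<forall>s\<in>T. \<forall>t\<in>T. s \<noteq> t \<longrightarrow> interior (fst s \<inter> fst t) = {})}"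

definition patch :: "('n::finite, 'l) tiling \<Rightarrow> real ^ 'n \<Rightarrow> real \<Rightarrow> ('n, 'l) tile set" where
  "patch T x r = {t \<in> T. fst t \<inter> ball x r \<noteq> {}}"

definition aperiodic :: "('n::finite, 'l) tiling \<Rightarrow> bool" where
  "aperiodic T \<longleftrightarrow> (\<forall>x. x \<noteq> 0 \<longrightarrow> T \<ominus> x \<noteq> T)"

definition patch_class :: "('n::finite, 'l) tile set \<Rightarrow> ('n, 'l) tile set set" where
  "patch_class Q = range (\<lambda>v. Q \<ominus> v)"

definition finite_local_complexity :: "('n::finite, 'l) tiling \<Rightarrow> bool" where
  "finite_local_complexity T \<longleftrightarrow> (\<forall>R>0. finite (range (\<lambda>x. patch_class (patch T x R))))"

definition repetitive :: "('n::finite, 'l) tiling \<Rightarrow> bool" where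
  "repetitive T \<longleftrightarrow>
     (\<forall>Q. finite Q \<and> Q \<subseteq> T \<longrightarrow> (\<exists>R>0. \<forall>x. \<exists>v. Q \<ominus> v \<subseteq> patch T x R))"

definition agreement_radii :: "('n::finite, 'l) tiling \<Rightarrow> ('n, 'l) tiling \<Rightarrow> real set" where
  "agreement_radii T\<^sub>1 T\<^sub>2 = {\<epsilon>. \<epsilon> > 0 \<and>
     (\<exists>x\<^sub>1 x\<^sub>2. norm x\<^sub>1 \<le> \<epsilon> \<and> norm x\<^sub>2 \<le> \<epsilon> \<and>
        patch (T\<^sub>1 \<ominus> x\<^sub>1) 0 (1 / \<epsilon>) = patch (T\<^sub>2 \<ominus> x\<^sub>2) 0 (1 / \<epsilon>))}"

text \<open>The set of admissible radii can be empty, for example if the two tilings have no prototile in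
  common; its infimum is then infinite.\<close>

definition tiling_dist :: "('n::finite, 'l) tiling \<Rightarrow> ('n, 'l) tiling \<Rightarrow> real" where
  "tiling_dist T\<^sub>1 T\<^sub>2 =
     (if agreement_radii T\<^sub>1 T\<^sub>2 = {} then 1 / sqrt 2
      else min (1 / sqrt 2) (Inf (agreement_radii T\<^sub>1 T\<^sub>2)))"

definition tiling_topology :: "('n::finite, 'l) tile set set \<Rightarrow> ('n, 'l) tiling topology" where
  "tiling_topology P = Metric_space.mtopology (tilings P) tiling_dist"

definition tiling_hull :: "('n::finite, 'l) tile set set \<Rightarrow> ('n, 'l) tiling \<Rightarrow> ('n, 'l) tiling set" where
  "tiling_hull P T = tiling_topology P closure_of (range (\<lambda>x. T \<ominus> x))"

definition aperiodic_minimal_FLC_space ::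
    "('n::finite, 'l) tile set set \<Rightarrow> ('n, 'l) tiling set \<Rightarrow> bool" where
  "aperiodic_minimal_FLC_space P \<Omega> \<longleftrightarrow>
     finite P \<and> (\<forall>p\<in>P. prototile p) \<and>
     (\<exists>T\<in>tilings P. aperiodic T \<and> repetitive T \<and> finite_local_complexity T \<and> \<Omega> = tiling_hull P T)"

abbreviation space_topology ::
    "('n::finite, 'l) tile set set \<Rightarrow> ('n, 'l) tiling set \<Rightarrow> ('n, 'l) tiling topology" where
  "space_topology P \<Omega> \<equiv> subtopology (tiling_topology P) \<Omega>"

text \<open>The function written \<open>h\<^sub>T\<close> in the literature. For a homeomorphism of aperiodic minimal tiling
  spaces with finite local complexity the described vector exists, because orbits are the path
  components, and it is unique by aperiodicity.\<close>

definition orbit_map ::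
    "(('n::finite, 'l) tiling \<Rightarrow> ('n, 'm) tiling) \<Rightarrow> ('n, 'l) tiling \<Rightarrow> real ^ 'n \<Rightarrow> real ^ 'n" where
  "orbit_map h T x = (THE v. h (T \<ominus> x) = h T \<ominus> v)"

end

theory Submission
  imports Defs
begin

text \<open>The theorem rests on a rigidity property. As there are finitely many prototiles, all tiles
  contain balls of one common radius \<open>\<eta>\<close>. Hence a tiling never contains two distinct translates of a
  tile by vectors at distance less than \<open>\<eta>\<close>, and if two tilings agree near the origin up to a small
  translation, then the translation vector is determined by them
  (\<open>patch_displacement_unique\<close>). In particular \<open>tiling_dist\<close> is a metric.

  Let a connected family of tilings have small diameter. The vector that moves each member into
  agreement with a fixed one near the origin is unique, so if it is corrected along
  the family then patches of every radius become locally constant, hence constant by connectedness.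
  The corrected members are therefore equal, that is, the family lies in a small piece of a
  single orbit (\<open>connected_small_in_orbit\<close>). Applied to \<open>x \<mapsto> h (T \<ominus> x)\<close> on small balls, this shows that
  membership in the orbit of \<open>h T\<close> is locally constant in \<open>x\<close>, so that \<open>h\<close> maps orbits to orbits and
  a vector \<open>h\<^sub>T(x)\<close> exists (\<open>orbit_to_orbit\<close>). It is unique because repetitivity transfers finite patches, and
  with them non-periodicity, from a tiling to all elements of its hull (\<open>aperiodic_tiling_hull\<close>).

  For joint continuity let \<open>x\<close> be small and \<open>(T', y)\<close> close to \<open>(T, x)\<close>. Both
  \<open>h\<^sub>T(x)\<close> and \<open>h\<^bsub>T'\<^esub>(y)\<close> are small, \<open>h T\<close> is close to \<open>h T'\<close>, and \<open>h T \<ominus> h\<^sub>T(x)\<close> is close to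
  \<open>h T' \<ominus> h\<^bsub>T'\<^esub>(y)\<close>; rigidity forces the two vectors to be close (\<open>nearby_displacements\<close>). The cocycle
  identity \<open>h\<^sub>T(x + z) = h\<^sub>T(x) + h\<^bsub>T \<ominus> x\<^esub>(z)\<close> then shows that joint continuity at \<open>(T, x)\<close> is a locally
  constant property of \<open>x\<close>; as it holds at \<open>x = 0\<close>, it holds everywhere
  (\<open>jointly_continuous\<close>). The same argument applies to the
  inverse of \<open>h\<close>, whose orbit map at \<open>h T\<close> inverts that of \<open>h\<close> at \<open>T\<close> by uniqueness.\<close>

section \<open>Translates and patches\<close>

lemma shift_tile_0 [simp]: "shift_tile t 0 = t"
  by (simp add: shift_tile_def)

lemma shift_tile_shift_tile [simp]: "shift_tile (shift_tile t x) y = shift_tile t (x + y)"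
  by (simp add: shift_tile_def image_image algebra_simps)

lemma shift_0 [simp]: "T \<ominus> 0 = T"
  by (simp add: shift_def)

lemma shift_shift: "(T \<ominus> x) \<ominus> y = T \<ominus> (x + y)"
  by (simp add: shift_def image_image)

lemma shift_tile_in_shift: "t \<in> T \<Longrightarrow> shift_tile t x \<in> T \<ominus> x"
  by (simp add: shift_def)

lemma mem_shift_iff: "t \<in> T \<ominus> x \<longleftrightarrow> shift_tile t (- x) \<in> T"
proof
  assume "shift_tile t (- x) \<in> T"
  from shift_tile_in_shift [OF this, of x] show "t \<in> T \<ominus> x" by simp
qed (auto simp: shift_def)

lemma fst_shift_tile: "fst (shift_tile t x) = (+) (- x) ` fst t"
  by (auto simp: shift_tile_def)

lemma mem_fst_shift_tile: "y \<in> fst (shift_tile t x) \<longleftrightarrow> y + x \<in> fst t"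
  by (auto simp: shift_tile_def algebra_simps image_iff)

lemma interior_shift_tile: "interior (fst (shift_tile t x)) = (+) (- x) ` interior (fst t)"
  by (simp only: fst_shift_tile interior_translation)

lemma is_tile_shift_tile:
  fixes t :: "('n::finite, 'l) tile"
  shows "is_tile (shift_tile t x) \<longleftrightarrow> is_tile t"
proof -
  have "is_tile (shift_tile t x)" if "is_tile t" for t :: "('n, 'l) tile" and x
  proof -
    have "fst (shift_tile t x) homeomorphic fst t"
      unfolding fst_shift_tile by (rule homeomorphic_sym [THEN iffD1, OF homeomorphic_translation])
    moreover have "closure (interior (fst (shift_tile t x))) = fst (shift_tile t x)"
      using that unfolding is_tile_def fst_shift_tile interior_translation closure_translation
      by simp
    moreover have "compact (fst (shift_tile t x))"
      using that unfolding is_tile_def fst_shift_tile by (intro compact_translation) simp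
    ultimately show ?thesis
      using that homeomorphic_trans unfolding is_tile_def by blast
  qed
  from this [of t x] this [of "shift_tile t x" "- x"] show ?thesis by auto
qed

lemma tile_class_shift_tile: "tile_class (shift_tile t x) = tile_class t"
proof -
  have "shift_tile t y \<in> range (shift_tile (shift_tile t x))" for y
    by (rule range_eqI [of _ _ "y - x"]) simp
  then show ?thesis by (auto simp: tile_class_def)
qed

lemma patch_shift:
  fixes T :: "('n::finite, 'l) tiling"
  shows "patch (T \<ominus> x) y r = patch T (x + y) r \<ominus> x"
proof -
  have meets: "fst t \<inter> ball y r \<noteq> {} \<longleftrightarrow> fst (shift_tile t (- x)) \<inter> ball (x + y) r \<noteq> {}" for t :: "('n, 'l) tile"
  proof -
    have "fst (shift_tile t (- x)) \<inter> ball (x + y) r = (+) x ` (fst t \<inter> ball y r)"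
      by (simp only: fst_shift_tile translation_Int ball_translation minus_minus)
    then show ?thesis by simp
  qed
  show ?thesis
    by (intro set_eqI) (simp only: mem_shift_iff patch_def mem_Collect_eq meets)
qed

lemma patch_eq_subball:
  fixes S S' :: "('n::finite, 'l) tiling"
  assumes "patch S a r = patch S' a r" "ball b s \<subseteq> ball a r"
  shows "patch S b s = patch S' b s"
proof -
  have "patch T b s = {t \<in> patch T a r. fst t \<inter> ball b s \<noteq> {}}" for T :: "('n, 'l) tiling"
    using assms(2) unfolding patch_def by blast
  from this [of S] this [of S'] show ?thesis using assms(1) by simp
qed

lemma patch_eq_shift:
  assumes "patch S 0 r = patch S' 0 r" "s + norm x \<le> r"
  shows "patch (S \<ominus> x) 0 s = patch (S' \<ominus> x) 0 s"
proof -
  have "ball x s \<subseteq> ball 0 r"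
    using assms(2) by (simp add: ball_subset_ball_iff)
  then show ?thesis
    using patch_eq_subball [OF assms(1)] by (simp add: patch_shift)
qed

section \<open>Tilings and the rigidity of small displacements\<close>

lemma tilings_overlap_eq:
  assumes "T \<in> tilings P" "s \<in> T" "t \<in> T" "interior (fst s) \<inter> interior (fst t) \<noteq> {}"
  shows "s = t"
proof (rule ccontr)
  assume "s \<noteq> t"
  then have "interior (fst s \<inter> fst t) = {}"
    using assms(1-3) unfolding tilings_def by blast
  with assms(4) show False by simp
qed

lemma tilings_shift:
  assumes "T \<in> tilings P"
  shows "T \<ominus> x \<in> tilings P"
proof -
  have "\<exists>t\<in>T. y \<in> fst (shift_tile t x)" for y
  proof -
    have "y + x \<in> (\<Union>t\<in>T. fst t)" using assms by (simp add: tilings_def)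
    then show ?thesis by (auto simp: mem_fst_shift_tile)
  qed
  then have "(\<Union>t\<in>T \<ominus> x. fst t) = UNIV"
    by (auto simp: shift_def)
  moreover have "interior (fst (shift_tile s x) \<inter> fst (shift_tile t x)) = {}"
    if "s \<in> T" "t \<in> T" "shift_tile s x \<noteq> shift_tile t x" for s t
  proof -
    have "interior (fst s) \<inter> interior (fst t) = {}"
      using tilings_overlap_eq [OF assms] that by blast
    then show ?thesis
      by (simp only: interior_Int interior_shift_tile translation_Int [symmetric] image_empty)
  qed
  ultimately show ?thesis
    using assms by (auto simp: tilings_def shift_def is_tile_shift_tile tile_class_shift_tile)
qed

lemma is_tile_interior_nonempty:
  assumes "is_tile t"
  shows "interior (fst t) \<noteq> {}"
proof
  assume "interior (fst t) = {}"
  then have "fst t = {}" using assms by (auto simp: is_tile_def)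
  then show False using assms by (auto simp: is_tile_def)
qed

lemma tilings_cover:
  assumes "T \<in> tilings P"
  shows "\<exists>t\<in>T. x \<in> fst t"
proof -
  have "x \<in> (\<Union>t\<in>T. fst t)" using assms by (simp add: tilings_def)
  then show ?thesis by simp
qed

text \<open>A tile is the closure of its interior, so a tile that has boundary points in an open set
  also has interior points there.\<close>

lemma tile_through_interior_overlaps:
  assumes "is_tile t" "p \<in> fst t" "open U" "p \<in> U"
  shows "interior (fst t) \<inter> U \<noteq> {}"
proof -
  have "p \<in> closure (interior (fst t))" using assms by (simp add: is_tile_def)
  then show ?thesis using assms by (meson disjoint_iff open_Int_closure_eq_empty)
qed

text \<open>There is no room for an additional tile: it would overlap one of the tiles that already cover
  its interior points.\<close>

lemma tilings_subset_imp_eq: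
  assumes "S \<in> tilings P" "T \<in> tilings P" "S \<subseteq> T"
  shows "S = T"
proof
  show "T \<subseteq> S"
  proof
    fix t assume t: "t \<in> T"
    then have "is_tile t" using assms by (simp add: tilings_def)
    then obtain p where p: "p \<in> interior (fst t)" using is_tile_interior_nonempty by blast
    obtain s where s: "s \<in> S" "p \<in> fst s" using tilings_cover [OF assms(1)] by blast
    then have "is_tile s" using assms by (simp add: tilings_def)
    then have "interior (fst s) \<inter> interior (fst t) \<noteq> {}"
      using tile_through_interior_overlaps s p by blast
    then have "s = t" using tilings_overlap_eq [OF assms(2) _ t] s assms by blast
    then show "t \<in> S" using s by simp
  qed
qed (fact assms)

text \<open>A bounded set is not invariant under a nonzero translation: a point that is extreme in the
  direction of the translation would be moved further out.\<close>

lemma shift_tile_eq_imp: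
  assumes "is_tile t" "shift_tile t a = shift_tile t b"
  shows "a = b"
proof (rule ccontr)
  assume "a \<noteq> b"
  have "compact (fst t)" "fst t \<noteq> {}"
    using assms is_tile_interior_nonempty [of t] interior_subset [of "fst t"]
    by (auto simp: is_tile_def)
  moreover have "continuous_on (fst t) (inner (a - b))"
    by (intro continuous_intros)
  ultimately obtain m where m: "m \<in> fst t" "\<And>y. y \<in> fst t \<Longrightarrow> inner (a - b) y \<le> inner (a - b) m"
    using continuous_attains_sup [of "fst t" "inner (a - b)"] by blast
  have "m - b \<in> fst (shift_tile t b)" using m by (simp add: mem_fst_shift_tile)
  then have "m + (a - b) \<in> fst t"
    using assms(2) by (metis mem_fst_shift_tile add.commute add_diff_eq diff_add_eq)
  from m(2) [OF this] have "inner (a - b) (a - b) \<le> 0" by (simp add: inner_add_right)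
  with \<open>a \<noteq> b\<close> show False by (metis inner_gt_zero_iff not_le right_minus_eq)
qed

definition inradius_bound :: "('n::finite, 'l) tile set set \<Rightarrow> real \<Rightarrow> bool" where
  "inradius_bound P \<eta> \<longleftrightarrow>
     \<eta> > 0 \<and> (\<forall>t. is_tile t \<and> tile_class t \<in> P \<longrightarrow> (\<exists>c. ball c \<eta> \<subseteq> fst t))"

lemma inradius_bound_exists:
  assumes "finite P" "\<forall>p\<in>P. prototile p"
  shows "\<exists>\<eta>. inradius_bound P \<eta>"
  using assms
proof (induction P rule: finite_induct)
  case empty
  show ?case by (rule exI [of _ 1]) (simp add: inradius_bound_def)
next
  case (insert p P)
  then obtain \<eta> where \<eta>: "inradius_bound P \<eta>" by auto
  obtain t where t: "is_tile t" "p = tile_class t"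
    using insert.prems by (auto simp: prototile_def)
  obtain c e where e: "e > 0" "ball c e \<subseteq> fst t"
    using is_tile_interior_nonempty [OF t(1)] by (meson equals0I mem_interior)
  have "\<exists>c. ball c e \<subseteq> fst s" if "tile_class s = p" for s
  proof -
    have "s \<in> range (shift_tile s)"
      by (metis rangeI shift_tile_0)
    then have "s \<in> range (shift_tile t)" using that t(2) by (simp add: tile_class_def)
    then obtain x where x: "s = shift_tile t x" by blast
    have "ball (c - x) e \<subseteq> fst s"
    proof
      fix y assume "y \<in> ball (c - x) e"
      then have "y + x \<in> ball c e" by (simp add: dist_norm algebra_simps)
      then show "y \<in> fst s" using e x by (auto simp: mem_fst_shift_tile)
    qed
    then show ?thesis by blast
  qed
  then have "\<exists>c. ball c (min e \<eta>) \<subseteq> fst s" if "is_tile s" "tile_class s \<in> insert p P" for s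
    using that \<eta> subset_ball [of "min e \<eta>" e] subset_ball [of "min e \<eta>" \<eta>]
    unfolding inradius_bound_def by (metis insertE min.cobounded1 min.cobounded2 order_trans)
  then have "inradius_bound (insert p P) (min e \<eta>)"
    using e \<eta> by (auto simp: inradius_bound_def)
  then show ?case by blast
qed

text \<open>The two translates of a ball of radius \<open>\<eta>\<close> in \<open>t\<close> overlap, so the two tiles are equal, and a
  tile determines its position.\<close>

lemma small_displacement_unique:
  assumes "inradius_bound P \<eta>" "T \<in> tilings P"
    and "shift_tile t a \<in> T" "shift_tile t b \<in> T" "norm (a - b) < \<eta>"
  shows "a = b"
proof -
  have t: "is_tile t" "tile_class t \<in> P"
    using assms(2,3) by (auto simp: tilings_def is_tile_shift_tile tile_class_shift_tile)
  then obtain c where c: "ball c \<eta> \<subseteq> fst t" using assms(1) unfolding inradius_bound_def by blast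
  then have "ball c \<eta> \<subseteq> interior (fst t)" by (simp add: interior_maximal)
  moreover have "c \<in> ball c \<eta>" "c - a + b \<in> ball c \<eta>"
    using assms(1,5) by (auto simp: inradius_bound_def dist_norm)
  ultimately have "c - a \<in> interior (fst (shift_tile t a)) \<inter> interior (fst (shift_tile t b))"
    by (auto simp: interior_shift_tile image_iff algebra_simps intro!: bexI [of _ "c - a + b"])
  then have "shift_tile t a = shift_tile t b"
    using tilings_overlap_eq [OF assms(2-4)] by blast
  then show ?thesis using shift_tile_eq_imp t by blast
qed

text \<open>The tile of \<open>S\<close> at the origin occurs in both translates of \<open>S'\<close>; this turns the
  preceding statement about tiles into one about patches.\<close>

lemma patch_displacement_unique:
  assumes "inradius_bound P \<eta>" "S \<in> tilings P" "S' \<in> tilings P"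
    and "patch S 0 r = patch (S' \<ominus> a) 0 r" "patch S 0 r = patch (S' \<ominus> b) 0 r" "r > 0"
    and "norm (a - b) < \<eta>"
  shows "a = b"
proof -
  obtain t where t: "t \<in> S" "0 \<in> fst t" using tilings_cover [OF assms(2)] by blast
  then have "t \<in> patch S 0 r" using \<open>r > 0\<close> by (force simp: patch_def)
  then have "t \<in> S' \<ominus> a" "t \<in> S' \<ominus> b" using assms(4,5) by (auto simp: patch_def)
  then have "- a = - b"
    using small_displacement_unique [OF assms(1,3), of t "- a" "- b"] assms(7)
    by (simp add: mem_shift_iff norm_minus_commute)
  then show ?thesis by simp
qed

section \<open>The metric on tilings\<close>

lemma agreement_radii_upward:
  assumes "\<epsilon> \<in> agreement_radii S S'" "\<epsilon> \<le> \<delta>"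
  shows "\<delta> \<in> agreement_radii S S'"
proof -
  obtain x y where xy: "\<epsilon> > 0" "norm x \<le> \<epsilon>" "norm y \<le> \<epsilon>"
      "patch (S \<ominus> x) 0 (1 / \<epsilon>) = patch (S' \<ominus> y) 0 (1 / \<epsilon>)"
    using assms(1) by (auto simp: agreement_radii_def)
  have "patch (S \<ominus> x) 0 (1 / \<delta>) = patch (S' \<ominus> y) 0 (1 / \<delta>)"
    using xy assms(2) by (intro patch_eq_subball [OF xy(4)] subset_ball) (simp add: frac_le)
  with xy assms(2) show ?thesis
    unfolding agreement_radii_def mem_Collect_eq by (metis order_less_le_trans order_trans)
qed

lemma bdd_below_agreement_radii: "bdd_below (agreement_radii S S')"
  by (rule bdd_belowI [of _ 0]) (simp add: agreement_radii_def)

lemma tiling_dist_le: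
  assumes "\<epsilon> \<in> agreement_radii S S'"
  shows "tiling_dist S S' \<le> \<epsilon>"
  using assms cInf_lower [OF assms bdd_below_agreement_radii]
  by (auto simp: tiling_dist_def intro: min.coboundedI2)

lemma tiling_dist_less_imp:
  assumes "tiling_dist S S' < \<epsilon>" "\<epsilon> \<le> 1 / sqrt 2"
  shows "\<epsilon> \<in> agreement_radii S S'"
proof -
  have "agreement_radii S S' \<noteq> {}" "Inf (agreement_radii S S') < \<epsilon>"
    using assms by (auto simp: tiling_dist_def split: if_splits)
  then obtain \<delta> where "\<delta> \<in> agreement_radii S S'" "\<delta> < \<epsilon>"
    using cInf_lessD by blast
  then show ?thesis by (rule agreement_radii_upward [OF _ less_imp_le])
qed

lemma tiling_dist_nonneg: "0 \<le> tiling_dist S S'"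
  by (auto simp: tiling_dist_def agreement_radii_def intro!: cInf_greatest)

lemma tiling_dist_commute:
  fixes S S' :: "('n::finite, 'l) tiling"
  shows "tiling_dist S S' = tiling_dist S' S"
proof -
  have "agreement_radii S S' \<subseteq> agreement_radii S' S" for S S' :: "('n, 'l) tiling"
  proof
    fix \<epsilon> assume "\<epsilon> \<in> agreement_radii S S'"
    then obtain x y where "\<epsilon> > 0" "norm x \<le> \<epsilon>" "norm y \<le> \<epsilon>"
      "patch (S \<ominus> x) 0 (1 / \<epsilon>) = patch (S' \<ominus> y) 0 (1 / \<epsilon>)"
      by (auto simp: agreement_radii_def)
    then show "\<epsilon> \<in> agreement_radii S' S"
      unfolding agreement_radii_def by (intro CollectI conjI exI [of _ y] exI [of _ x]) simp_all
  qed
  then have "agreement_radii S S' = agreement_radii S' S" by (intro subset_antisym)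
  then show ?thesis by (simp add: tiling_dist_def)
qed

lemma tiling_dist_le_inverse_sqrt_2: "tiling_dist S S' \<le> 1 / sqrt 2"
  by (auto simp: tiling_dist_def)

text \<open>The definition of the distance moves both tilings. The next two lemmas compare it, up to a
  factor 2, with the version in which only the second tiling is moved, by a vector \<open>w\<close>; all later
  estimates are about this \<open>w\<close>.\<close>

lemma tiling_dist_displacement_le:
  fixes w :: "real ^ 'n::finite"
  assumes "patch S 0 (1 / \<epsilon>) = patch (S' \<ominus> w) 0 (1 / \<epsilon>)" "norm w \<le> \<epsilon>" "\<epsilon> > 0"
  shows "tiling_dist S S' \<le> \<epsilon>"
proof (rule tiling_dist_le)
  have "patch (S \<ominus> 0) 0 (1 / \<epsilon>) = patch (S' \<ominus> w) 0 (1 / \<epsilon>)" "norm (0 :: real ^ 'n) \<le> \<epsilon>"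
    using assms by auto
  with assms show "\<epsilon> \<in> agreement_radii S S'"
    unfolding agreement_radii_def by blast
qed

lemma tiling_dist_less_displacement:
  assumes "tiling_dist S S' < \<epsilon> / 2" "\<epsilon> \<le> 1"
  shows "\<exists>w. norm w \<le> \<epsilon> \<and> patch S 0 (1 / \<epsilon>) = patch (S' \<ominus> w) 0 (1 / \<epsilon>)"
proof -
  have "sqrt 2 \<le> 2" by (simp add: real_le_lsqrt)
  then have "1 / 2 \<le> 1 / sqrt 2" by (simp add: frac_le)
  with assms(2) have "\<epsilon> / 2 \<le> 1 / sqrt 2" by linarith
  with assms(1) have "\<epsilon> / 2 \<in> agreement_radii S S'" by (rule tiling_dist_less_imp)
  then obtain x y where xy: "\<epsilon> > 0" "norm x \<le> \<epsilon> / 2" "norm y \<le> \<epsilon> / 2"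
      "patch (S \<ominus> x) 0 (2 / \<epsilon>) = patch (S' \<ominus> y) 0 (2 / \<epsilon>)"
    by (auto simp: agreement_radii_def)
  have "\<epsilon> \<le> 1 / \<epsilon>" "2 / \<epsilon> = 1 / \<epsilon> + 1 / \<epsilon>"
    using xy(1) assms(2) by (simp_all add: pos_le_divide_eq mult_le_one)
  moreover have "norm (- x) \<le> \<epsilon>" using xy(1,2) by simp
  ultimately have "1 / \<epsilon> + norm (- x) \<le> 2 / \<epsilon>" by linarith
  from patch_eq_shift [OF xy(4) this]
  have "patch S 0 (1 / \<epsilon>) = patch (S' \<ominus> (y - x)) 0 (1 / \<epsilon>)"
    by (simp add: shift_shift)
  moreover have "norm (y - x) \<le> \<epsilon>" using xy norm_triangle_ineq4 [of y x] by linarith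
  ultimately show ?thesis by blast
qed

text \<open>Moving by the vectors for the other pair costs part of the radius of agreement. The
  remaining radius suffices since \<open>1 / (\<epsilon> + \<delta>) + \<delta> \<le> 1 / \<epsilon>\<close> is equivalent to \<open>\<epsilon> (\<epsilon> + \<delta>) \<le> 1\<close>.\<close>

lemma agreement_radii_triangle:
  assumes "\<epsilon> \<in> agreement_radii S S'" "\<delta> \<in> agreement_radii S' S''" "\<epsilon> + \<delta> \<le> 1"
  shows "\<epsilon> + \<delta> \<in> agreement_radii S S''"
proof -
  obtain x y where xy: "\<epsilon> > 0" "norm x \<le> \<epsilon>" "norm y \<le> \<epsilon>"
      "patch (S \<ominus> x) 0 (1 / \<epsilon>) = patch (S' \<ominus> y) 0 (1 / \<epsilon>)"
    using assms by (auto simp: agreement_radii_def)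
  obtain u v where uv: "\<delta> > 0" "norm u \<le> \<delta>" "norm v \<le> \<delta>"
      "patch (S' \<ominus> u) 0 (1 / \<delta>) = patch (S'' \<ominus> v) 0 (1 / \<delta>)"
    using assms by (auto simp: agreement_radii_def)
  have radius: "1 / (a + b) + b \<le> 1 / a" if "a > 0" "b > 0" "a + b \<le> 1" for a b :: real
  proof -
    have "a * (a + b) \<le> 1" using that by (intro mult_le_one) auto
    then have "b * (a * (a + b)) \<le> b * 1" using that by (intro mult_left_mono) auto
    then have "b \<le> b / (a * (a + b))" using that by (simp add: pos_le_divide_eq)
    also have "\<dots> = 1 / a - 1 / (a + b)" using that by (simp add: field_simps)
    finally show ?thesis by simp
  qed
  have "1 / (\<epsilon> + \<delta>) + norm u \<le> 1 / \<epsilon>" using radius [of \<epsilon> \<delta>] xy uv assms(3) by linarith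
  note 1 = patch_eq_shift [OF xy(4) this]
  have "1 / (\<epsilon> + \<delta>) + norm y \<le> 1 / \<delta>"
    using radius [of \<delta> \<epsilon>] xy uv assms(3) by (simp add: add.commute)
  note 2 = patch_eq_shift [OF uv(4) this]
  have "patch (S \<ominus> (x + u)) 0 (1 / (\<epsilon> + \<delta>)) = patch (S'' \<ominus> (v + y)) 0 (1 / (\<epsilon> + \<delta>))"
    using 1 2 by (simp add: shift_shift add.commute)
  moreover have "norm (x + u) \<le> \<epsilon> + \<delta>" "norm (v + y) \<le> \<epsilon> + \<delta>"
    using xy uv norm_triangle_mono [of x \<epsilon> u \<delta>] norm_triangle_mono [of y \<epsilon> v \<delta>]
    by (simp_all add: add.commute)
  ultimately show ?thesis using xy uv by (auto simp: agreement_radii_def)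
qed

text \<open>The truncation of the distance at \<open>1 / sqrt 2 \<le> 1\<close> ensures that only sums \<open>\<epsilon> + \<delta> \<le> 1\<close>
  matter.\<close>

lemma tiling_dist_triangle: "tiling_dist S S'' \<le> tiling_dist S S' + tiling_dist S' S''"
proof (rule ccontr)
  assume "\<not> ?thesis"
  then obtain c where c: "tiling_dist S S' + tiling_dist S' S'' < c" "c < tiling_dist S S''"
    by (meson dense not_le)
  define \<epsilon> where "\<epsilon> = tiling_dist S S' + (c - tiling_dist S S' - tiling_dist S' S'') / 2"
  define \<delta> where "\<delta> = tiling_dist S' S'' + (c - tiling_dist S S' - tiling_dist S' S'') / 2"
  have ed: "\<epsilon> + \<delta> = c" "tiling_dist S S' < \<epsilon>" "tiling_dist S' S'' < \<delta>"
    using c by (auto simp: \<epsilon>_def \<delta>_def field_simps)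
  have nn: "0 \<le> tiling_dist S S'" "0 \<le> tiling_dist S' S''" by (rule tiling_dist_nonneg)+
  have lt: "c < 1 / sqrt 2" using c(2) tiling_dist_le_inverse_sqrt_2 [of S S''] by linarith
  have "1 / sqrt 2 \<le> (1::real)" by simp
  with lt have "c \<le> 1" by linarith
  then have "\<epsilon> + \<delta> \<in> agreement_radii S S''"
    using ed nn lt
    by (intro agreement_radii_triangle [of _ _ S'] tiling_dist_less_imp) auto
  then show False using tiling_dist_le c(2) ed(1) by fastforce
qed

lemma tiling_dist_shift_le: "tiling_dist (T \<ominus> x) (T \<ominus> y) \<le> norm (x - y)"
proof (rule field_le_epsilon)
  fix e :: real assume "e > 0"
  have "patch (T \<ominus> x) 0 r = patch ((T \<ominus> y) \<ominus> (x - y)) 0 r" for r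
    by (simp add: shift_shift)
  then show "tiling_dist (T \<ominus> x) (T \<ominus> y) \<le> norm (x - y) + e"
    using \<open>e > 0\<close>
    by (intro tiling_dist_displacement_le [where w = "x - y"]) (auto intro: add_nonneg_pos)
qed

lemma tiling_dist_refl [simp]: "tiling_dist T T = 0"
  using tiling_dist_shift_le [of T 0 0] tiling_dist_nonneg [of T T] by simp

lemma eq_if_all_patches_eq:
  fixes S S' :: "('n::finite, 'l) tiling"
  assumes "\<And>r. r > 0 \<Longrightarrow> patch S 0 r = patch S' 0 r"
    and "S \<in> tilings P" "S' \<in> tilings P'"
  shows "S = S'"
proof -
  have "t \<in> S'" if "t \<in> S" "S \<in> tilings P" "\<And>r. r > 0 \<Longrightarrow> patch S 0 r = patch S' 0 r"
    for t and S S' :: "('n, 'l) tiling" and P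
  proof -
    have "is_tile t" using that by (simp add: tilings_def)
    then obtain p where "p \<in> fst t"
      using is_tile_interior_nonempty interior_subset by blast
    then have "t \<in> patch S 0 (norm p + 1)" using that by (auto simp: patch_def disjoint_iff)
    moreover have "norm p + 1 > 0" by (simp add: add_nonneg_pos)
    ultimately have "t \<in> patch S' 0 (norm p + 1)" using that(3) by blast
    then show ?thesis by (simp add: patch_def)
  qed
  from this [of _ S P S'] this [of _ S' P' S] assms show ?thesis by (metis subsetI subset_antisym)
qed

text \<open>For all sufficiently small \<open>\<epsilon>\<close> the vector that witnesses a distance below \<open>\<epsilon>\<close> is the same by
  rigidity. Being arbitrarily small it is zero, and the tilings agree on all balls.\<close>

lemma tiling_dist_eq_0_imp_eq:
  assumes \<eta>: "inradius_bound P \<eta>" and S: "S \<in> tilings P" "S' \<in> tilings P"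
    and 0: "tiling_dist S S' = 0"
  shows "S = S'"
proof (rule eq_if_all_patches_eq [OF _ S])
  fix r :: real assume "r > 0"
  define \<epsilon> where "\<epsilon> = min (1 / r) (min 1 (\<eta> / 3))"
  have \<epsilon>: "\<epsilon> > 0" "\<epsilon> \<le> 1" "3 * \<epsilon> \<le> \<eta>" "\<epsilon> \<le> 1 / r"
    using \<open>r > 0\<close> \<eta> by (auto simp: \<epsilon>_def inradius_bound_def)
  have ex: "\<exists>w. norm w \<le> e \<and> patch S 0 (1 / e) = patch (S' \<ominus> w) 0 (1 / e)" if "0 < e" "e \<le> 1" for e
    using that 0 by (intro tiling_dist_less_displacement) auto
  obtain w where w: "norm w \<le> \<epsilon>" "patch S 0 (1 / \<epsilon>) = patch (S' \<ominus> w) 0 (1 / \<epsilon>)"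
    using ex \<epsilon> by blast
  have small: "norm w \<le> e" if e: "0 < e" "e \<le> \<epsilon>" for e
  proof -
    have "e \<le> 1" using e \<epsilon> by linarith
    then obtain u where u: "norm u \<le> e" "patch S 0 (1 / e) = patch (S' \<ominus> u) 0 (1 / e)"
      using ex [of e] e by blast
    have "patch S 0 (1 / \<epsilon>) = patch (S' \<ominus> u) 0 (1 / \<epsilon>)"
      using e \<epsilon> by (intro patch_eq_subball [OF u(2)] subset_ball) (simp add: frac_le)
    moreover have "norm (w - u) < \<eta>"
      using w(1) u(1) e \<epsilon> norm_triangle_ineq4 [of w u] by linarith
    ultimately have "w = u"
      using patch_displacement_unique [OF \<eta> S w(2)] \<epsilon> by simp
    with u show ?thesis by simp
  qed
  have "w = 0"
  proof (rule ccontr)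
    assume "w \<noteq> 0"
    then have "norm w \<le> min \<epsilon> (norm w / 2)" using \<epsilon>(1) by (intro small) auto
    with \<open>w \<noteq> 0\<close> show False by simp
  qed
  with w(2) have "patch S 0 (1 / \<epsilon>) = patch S' 0 (1 / \<epsilon>)" by simp
  moreover have "r \<le> 1 / \<epsilon>" using \<epsilon> \<open>r > 0\<close> by (simp add: field_simps)
  ultimately show "patch S 0 r = patch S' 0 r" by (rule patch_eq_subball [OF _ subset_ball])
qed

lemma Metric_space_tilings:
  fixes P :: "('n::finite, 'l) tile set set"
  assumes "inradius_bound P \<eta>"
  shows "Metric_space (tilings P) tiling_dist"
proof
  fix S S' S'' :: "('n, 'l) tiling"
  show "0 \<le> tiling_dist S S'" by (rule tiling_dist_nonneg)
  show "tiling_dist S S' = tiling_dist S' S" by (rule tiling_dist_commute)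
  show "tiling_dist S S'' \<le> tiling_dist S S' + tiling_dist S' S''" by (rule tiling_dist_triangle)
  show "tiling_dist S S' = 0 \<longleftrightarrow> S = S'" if "S \<in> tilings P" "S' \<in> tilings P"
    using tiling_dist_eq_0_imp_eq [OF assms that] tiling_dist_refl [of S] by blast
qed

text \<open>Joint continuity of the translation action, stated for an arbitrary filter so that it serves
  both for sequences and for limits in \<open>\<real>\<^sup>n\<close>. Translation by the limit vector \<open>x\<close> reduces the radius of
  agreement by \<open>norm x\<close>; replacing \<open>x\<close> by \<open>g n\<close> costs at most their distance.\<close>

lemma tiling_dist_shift_tendsto:
  assumes "((\<lambda>n. tiling_dist T (f n)) \<longlongrightarrow> 0) F" "(g \<longlongrightarrow> x) F"
  shows "((\<lambda>n. tiling_dist (T \<ominus> x) (f n \<ominus> g n)) \<longlongrightarrow> 0) F"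
proof -
  have fixed: "\<forall>\<^sub>F n in F. tiling_dist (T \<ominus> x) (f n \<ominus> x) < e" if "e > 0" for e
  proof -
    \<comment> \<open>Agreement on the ball of radius \<open>1 / \<epsilon>\<close> survives translation by \<open>x\<close> on the ball of radius
      \<open>2 / e\<close>.\<close>
    define \<epsilon> where "\<epsilon> = min 1 (1 / (2 / e + norm x))"
    have pos: "0 < 2 / e + norm x" using that by (simp add: add_pos_nonneg)
    then have "\<epsilon> > 0" by (simp add: \<epsilon>_def)
    have le: "2 / e + norm x \<le> 1 / \<epsilon>"
    proof -
      have "\<epsilon> \<le> 1 / (2 / e + norm x)" by (simp add: \<epsilon>_def)
      then have "1 / (1 / (2 / e + norm x)) \<le> 1 / \<epsilon>"
        using \<open>\<epsilon> > 0\<close> pos by (intro divide_left_mono) (auto intro!: mult_pos_pos divide_pos_pos)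
      then show ?thesis by simp
    qed
    have "2 / e \<le> 1 / \<epsilon>" using le norm_ge_zero [of x] by linarith
    then have "\<epsilon> \<le> e / 2" using \<open>\<epsilon> > 0\<close> that by (simp add: field_simps)
    have "\<forall>\<^sub>F n in F. tiling_dist T (f n) < \<epsilon> / 2"
      using order_tendstoD(2) [OF assms(1), of "\<epsilon> / 2"] \<open>\<epsilon> > 0\<close> by simp
    then show ?thesis
    proof eventually_elim
      case (elim n)
      then obtain w where w: "norm w \<le> \<epsilon>" "patch T 0 (1 / \<epsilon>) = patch (f n \<ominus> w) 0 (1 / \<epsilon>)"
        using tiling_dist_less_displacement [of T "f n" \<epsilon>] by (auto simp: \<epsilon>_def)
      have "patch (T \<ominus> x) 0 (2 / e) = patch ((f n \<ominus> x) \<ominus> w) 0 (2 / e)"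
        using patch_eq_shift [OF w(2) le] by (simp add: shift_shift add.commute)
      then have "tiling_dist (T \<ominus> x) (f n \<ominus> x) \<le> e / 2"
        using w \<open>\<epsilon> \<le> e / 2\<close> that by (intro tiling_dist_displacement_le [where w = w]) auto
      then show ?case using that by simp
    qed
  qed
  then have 1: "((\<lambda>n. tiling_dist (T \<ominus> x) (f n \<ominus> x)) \<longlongrightarrow> 0) F"
    by (auto simp: tendsto_iff tiling_dist_nonneg)
  have "((\<lambda>n. x - g n) \<longlongrightarrow> x - x) F"
    by (intro tendsto_diff tendsto_const assms(2))
  then have 2: "((\<lambda>n. norm (x - g n)) \<longlongrightarrow> 0) F"
    by (simp add: tendsto_norm_zero)
  show ?thesis
  proof (rule tendsto_sandwich [OF _ _ tendsto_const])
    show "((\<lambda>n. tiling_dist (T \<ominus> x) (f n \<ominus> x) + norm (x - g n)) \<longlongrightarrow> 0) F"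
      using tendsto_add [OF 1 2] by simp
    show "\<forall>\<^sub>F n in F. tiling_dist (T \<ominus> x) (f n \<ominus> g n)
        \<le> tiling_dist (T \<ominus> x) (f n \<ominus> x) + norm (x - g n)"
      by (intro always_eventually allI
          order_trans [OF tiling_dist_triangle add_left_mono [OF tiling_dist_shift_le]])
  qed (simp add: tiling_dist_nonneg)
qed

lemma LIMSEQ_0_if_less_inverse:
  assumes "\<And>n. 0 \<le> a n" "\<And>n. a n < inverse (real (Suc n))"
  shows "a \<longlonglongrightarrow> 0"
proof (rule tendsto_sandwich [OF _ _ tendsto_const LIMSEQ_inverse_real_of_nat])
  show "\<forall>\<^sub>F n in sequentially. 0 \<le> a n" using assms(1) by (intro always_eventually allI)
  show "\<forall>\<^sub>F n in sequentially. a n \<le> inverse (real (Suc n))"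
    using assms(2) by (intro always_eventually allI less_imp_le)
qed

section \<open>Small connected families of tilings\<close>

text \<open>Locally, a tiling space is the product of a ball of translations and a totally disconnected
  transversal; this is the part of that structure that the argument uses. Along a connected family only the
  translation can vary. The bound \<open>3 * \<delta> < \<eta>\<close> is what uniqueness needs for the sum of
  three displacements of norm at most \<open>\<delta>\<close>.\<close>

lemma connected_small_in_orbit:
  fixes \<gamma> :: "'a::topological_space \<Rightarrow> ('n::finite, 'l) tiling"
  assumes \<eta>: "inradius_bound P \<eta>" and "connected U" and tilings: "\<And>x. x \<in> U \<Longrightarrow> \<gamma> x \<in> tilings P"
    and cont: "\<And>x. x \<in> U \<Longrightarrow> ((\<lambda>y. tiling_dist (\<gamma> x) (\<gamma> y)) \<longlongrightarrow> 0) (at x within U)"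
    and a: "a \<in> U" and small: "\<And>x. x \<in> U \<Longrightarrow> tiling_dist (\<gamma> a) (\<gamma> x) < \<delta> / 2"
    and \<delta>: "0 < \<delta>" "\<delta> \<le> 1" "3 * \<delta> < \<eta>"
    and x: "x \<in> U"
  shows "\<exists>v. norm v \<le> \<delta> \<and> \<gamma> x = \<gamma> a \<ominus> v"
proof -
  have "\<forall>x\<in>U. \<exists>w. norm w \<le> \<delta> \<and> patch (\<gamma> a) 0 (1 / \<delta>) = patch (\<gamma> x \<ominus> w) 0 (1 / \<delta>)"
    using tiling_dist_less_displacement small \<delta> by blast
  then obtain w where w: "\<And>x. x \<in> U \<Longrightarrow> norm (w x) \<le> \<delta>"
      "\<And>x. x \<in> U \<Longrightarrow> patch (\<gamma> a) 0 (1 / \<delta>) = patch (\<gamma> x \<ominus> w x) 0 (1 / \<delta>)"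
    by metis
  have unique: "v = w x" if "x \<in> U" "norm (v - w x) < \<eta>"
      "patch (\<gamma> a) 0 (1 / \<delta>) = patch (\<gamma> x \<ominus> v) 0 (1 / \<delta>)" for x v
    using patch_displacement_unique [OF \<eta> tilings [OF a] tilings [OF that(1)] that(3) w(2) [OF that(1)]]
      \<delta>(1) that(2) by simp
  have "norm (0 - w a) < \<eta>" using w(1) [OF a] \<delta> by simp
  then have "w a = 0" using unique [OF a, of 0] by simp
  \<comment> \<open>After correction by \<open>w\<close>, the patches of any given radius are locally constant along \<open>U\<close>.\<close>
  have agree: "patch (\<gamma> a \<ominus> w a) 0 r = patch (\<gamma> x \<ominus> w x) 0 r" if "r > 0" for r
  proof (rule connected_local_const [OF \<open>connected U\<close> a x, of "\<lambda>x. patch (\<gamma> x \<ominus> w x) 0 r"], rule ballI)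
    fix y assume y: "y \<in> U"
    define R where "R = r + 1 / \<delta>"
    \<comment> \<open>Neighbours at distance below \<open>\<epsilon> / 2\<close> agree, up to a small displacement, on a ball that
      still contains, after a translation by \<open>w y\<close>, both the ball of radius \<open>r\<close> and the one of radius \<open>1 / \<delta>\<close> where \<open>w\<close> is determined.\<close>
    define \<epsilon> where "\<epsilon> = min \<delta> (1 / (R + \<delta>))"
    have R: "0 < R" "r \<le> R" "1 / \<delta> \<le> R" using that \<delta> by (auto simp: R_def add_pos_pos)
    have "\<epsilon> > 0" "\<epsilon> \<le> \<delta>" "\<epsilon> \<le> 1 / (R + \<delta>)" using R \<delta> by (auto simp: \<epsilon>_def)
    then have "R + \<delta> \<le> 1 / \<epsilon>"
      using R \<delta> by (simp add: pos_le_divide_eq mult.commute)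
    have "\<forall>\<^sub>F z in at y within U. tiling_dist (\<gamma> y) (\<gamma> z) < \<epsilon> / 2"
      using order_tendstoD(2) [OF cont [OF y], of "\<epsilon> / 2"] \<open>\<epsilon> > 0\<close> by simp
    moreover have "\<forall>\<^sub>F z in at y within U. z \<in> U"
      by (auto simp: eventually_at_topological)
    ultimately show "\<forall>\<^sub>F z in at y within U. patch (\<gamma> y \<ominus> w y) 0 r = patch (\<gamma> z \<ominus> w z) 0 r"
    proof eventually_elim
      case (elim z)
      then obtain u where u: "norm u \<le> \<epsilon>" "patch (\<gamma> y) 0 (1 / \<epsilon>) = patch (\<gamma> z \<ominus> u) 0 (1 / \<epsilon>)"
        using tiling_dist_less_displacement [of "\<gamma> y" "\<gamma> z" \<epsilon>] \<open>\<epsilon> \<le> \<delta>\<close> \<delta>(2) by auto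
      have "R + norm (w y) \<le> 1 / \<epsilon>" using w(1) [OF y] \<open>R + \<delta> \<le> 1 / \<epsilon>\<close> by linarith
      then have big: "patch (\<gamma> y \<ominus> w y) 0 R = patch (\<gamma> z \<ominus> (u + w y)) 0 R"
        using patch_eq_shift [OF u(2)] by (simp add: shift_shift)
      then have "patch (\<gamma> y \<ominus> w y) 0 (1 / \<delta>) = patch (\<gamma> z \<ominus> (u + w y)) 0 (1 / \<delta>)"
        by (rule patch_eq_subball) (intro subset_ball R)
      then have "patch (\<gamma> a) 0 (1 / \<delta>) = patch (\<gamma> z \<ominus> (u + w y)) 0 (1 / \<delta>)"
        using w(2) [OF y] by simp
      moreover have "norm (u + w y - w z) < \<eta>"
        using u(1) \<open>\<epsilon> \<le> \<delta>\<close> w(1) [OF y] w(1) [OF elim(2)] \<delta>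
          norm_triangle_ineq4 [of "u + w y" "w z"] norm_triangle_ineq [of u "w y"] by linarith
      \<comment> \<open>The correction at \<open>z\<close> is the one at \<open>y\<close> plus the displacement between the neighbours.\<close>
      ultimately have "u + w y = w z" using unique elim(2) by blast
      with big have "patch (\<gamma> y \<ominus> w y) 0 R = patch (\<gamma> z \<ominus> w z) 0 R" by simp
      then show ?case by (rule patch_eq_subball) (intro subset_ball R)
    qed
  qed
  have "\<gamma> a \<ominus> w a = \<gamma> x \<ominus> w x"
    using agree tilings_shift [OF tilings [OF a]] tilings_shift [OF tilings [OF x]]
    by (rule eq_if_all_patches_eq)
  with \<open>w a = 0\<close> have "\<gamma> a = \<gamma> x \<ominus> w x" by simp
  then have "\<gamma> x = \<gamma> a \<ominus> (- w x)" by (simp add: shift_shift)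
  then show ?thesis using w(1) [OF x] by (metis norm_minus_cancel)
qed

text \<open>The vector that matches \<open>S\<close> with \<open>S'\<close> near the origin and the one that matches their
  translates differ by \<open>a' - a\<close> on the common part, by rigidity. Smallness of \<open>a' - a\<close> with respect to
  \<open>\<eta>\<close> is thereby improved to smallness with respect to \<open>\<epsilon>\<close>.\<close>

lemma nearby_displacements:
  assumes "inradius_bound P \<eta>" "S \<in> tilings P" "S' \<in> tilings P"
    and "tiling_dist S S' < \<epsilon> / 2" "tiling_dist (S \<ominus> a) (S' \<ominus> a') < \<epsilon> / 2"
    and "\<epsilon> \<le> 1" "norm a < 1 / \<epsilon>" "norm (a' - a) + 2 * \<epsilon> < \<eta>"
  shows "norm (a' - a) \<le> 2 * \<epsilon>"
proof -
  obtain w where w: "norm w \<le> \<epsilon>" "patch S 0 (1 / \<epsilon>) = patch (S' \<ominus> w) 0 (1 / \<epsilon>)"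
    using tiling_dist_less_displacement assms by blast
  obtain w' where w': "norm w' \<le> \<epsilon>"
      "patch (S \<ominus> a) 0 (1 / \<epsilon>) = patch ((S' \<ominus> a') \<ominus> w') 0 (1 / \<epsilon>)"
    using tiling_dist_less_displacement assms by blast
  define s where "s = 1 / \<epsilon> - norm a"
  have "s > 0" using assms by (simp add: s_def)
  have "patch S 0 s = patch (S' \<ominus> (a' + w' - a)) 0 s"
    using patch_eq_shift [OF w'(2), of s "- a"] by (simp add: shift_shift s_def)
  moreover have "patch S 0 s = patch (S' \<ominus> w) 0 s"
    by (intro patch_eq_subball [OF w(2)] subset_ball) (simp add: s_def)
  moreover have "norm (a' + w' - a - w) \<le> norm (a' - a) + norm w' + norm w"
    using norm_triangle_ineq4 [of "a' - a + w'" w] norm_triangle_ineq [of "a' - a" w']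
    by (simp add: algebra_simps)
  then have "norm (a' + w' - a - w) < \<eta>" using w(1) w'(1) assms(8) by linarith
  ultimately have "a' + w' - a = w"
    using patch_displacement_unique [OF assms(1-3)] \<open>s > 0\<close> by blast
  then have "a' - a = w - w'" by (simp add: algebra_simps)
  then show ?thesis using norm_triangle_ineq4 [of w w'] w(1) w'(1) by simp
qed

section \<open>Orbit maps of continuous maps between tiling spaces\<close>

text \<open>To be interpreted twice: for a homeomorphism of tiling spaces and for its inverse.\<close>

locale tiling_space_map =
  fixes \<Omega> :: "('n::finite, 'l) tiling set" and P' :: "('n, 'm) tile set set"
    and \<Omega>' :: "('n, 'm) tiling set" and h :: "('n, 'l) tiling \<Rightarrow> ('n, 'm) tiling" and \<eta> :: real
  assumes inradius: "inradius_bound P' \<eta>"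
    and shift_closed: "T \<in> \<Omega> \<Longrightarrow> T \<ominus> x \<in> \<Omega>"
    and maps_to: "T \<in> \<Omega> \<Longrightarrow> h T \<in> \<Omega>'"
    and codomain: "\<Omega>' \<subseteq> tilings P'"
    and codomain_aperiodic: "S \<in> \<Omega>' \<Longrightarrow> aperiodic S"
    and h_continuous: "\<lbrakk>T \<in> \<Omega>; e > 0\<rbrakk> \<Longrightarrow>
          \<exists>d>0. \<forall>T'\<in>\<Omega>. tiling_dist T T' < d \<longrightarrow> tiling_dist (h T) (h T') < e"
begin

lemma h_tilings: "T \<in> \<Omega> \<Longrightarrow> h T \<in> tilings P'"
  using maps_to codomain by blast

lemma h_tendsto:
  assumes "T \<in> \<Omega>" "\<And>n. f n \<in> \<Omega>" "((\<lambda>n. tiling_dist T (f n)) \<longlongrightarrow> 0) F"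
  shows "((\<lambda>n. tiling_dist (h T) (h (f n))) \<longlongrightarrow> 0) F"
proof (rule tendstoI)
  fix e :: real assume "e > 0"
  then obtain d where d: "d > 0" "\<And>T'. T' \<in> \<Omega> \<Longrightarrow> tiling_dist T T' < d \<Longrightarrow> tiling_dist (h T) (h T') < e"
    using h_continuous [OF assms(1)] by blast
  have "\<forall>\<^sub>F n in F. tiling_dist T (f n) < d" using order_tendstoD(2) [OF assms(3) d(1)] .
  then show "\<forall>\<^sub>F n in F. dist (tiling_dist (h T) (h (f n))) 0 < e"
    by eventually_elim (use d(2) assms(2) in \<open>simp add: tiling_dist_nonneg\<close>)
qed

text \<open>The images of a small ball of translates form a small connected family, uniformly for all \<open>T'\<close>
  near \<open>T\<close>.\<close>

lemma small_translates_small_displacements: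
  assumes T: "T \<in> \<Omega>" and \<delta>: "0 < \<delta>" "\<delta> \<le> 1" "3 * \<delta> < \<eta>"
  shows "\<exists>d>0. \<forall>T'\<in>\<Omega>. \<forall>y. tiling_dist T T' < d \<longrightarrow> norm y < d \<longrightarrow>
           (\<exists>v. norm v \<le> \<delta> \<and> h (T' \<ominus> y) = h T' \<ominus> v)"
proof -
  obtain d where d: "d > 0" "\<And>T'. T' \<in> \<Omega> \<Longrightarrow> tiling_dist T T' < d \<Longrightarrow> tiling_dist (h T) (h T') < \<delta> / 4"
    using h_continuous [OF T, of "\<delta> / 4"] \<delta>(1) by auto
  have near: "tiling_dist (h T) (h (T' \<ominus> y)) < \<delta> / 4"
    if "T' \<in> \<Omega>" "tiling_dist T T' < d / 2" "norm y < d / 2" for T' y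
  proof -
    have "tiling_dist T (T' \<ominus> y) \<le> tiling_dist T T' + tiling_dist (T' \<ominus> 0) (T' \<ominus> y)"
      using tiling_dist_triangle [of T "T' \<ominus> y" T'] by simp
    also have "\<dots> < d" using that(2,3) tiling_dist_shift_le [of T' 0 y] by simp
    finally show ?thesis using d(2) shift_closed that(1) by blast
  qed
  have "\<exists>v. norm v \<le> \<delta> \<and> h (T' \<ominus> y) = h T' \<ominus> v"
    if T': "T' \<in> \<Omega>" "tiling_dist T T' < d / 2" and y: "norm y < d / 2" for T' y
  proof -
    have "\<exists>v. norm v \<le> \<delta> \<and> h (T' \<ominus> y) = h (T' \<ominus> 0) \<ominus> v"
    proof (rule connected_small_in_orbit [OF inradius, where U = "ball 0 (d / 2)"])
      fix x :: "real ^ 'n" assume x: "x \<in> ball 0 (d / 2)"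
      show "h (T' \<ominus> x) \<in> tilings P'" using h_tilings shift_closed T' by blast
      show "((\<lambda>y. tiling_dist (h (T' \<ominus> x)) (h (T' \<ominus> y))) \<longlongrightarrow> 0) (at x within ball 0 (d / 2))"
        by (intro h_tendsto shift_closed T' tiling_dist_shift_tendsto tendsto_ident_at) simp
      have "tiling_dist (h (T' \<ominus> 0)) (h (T' \<ominus> x))
          \<le> tiling_dist (h T) (h (T' \<ominus> 0)) + tiling_dist (h T) (h (T' \<ominus> x))"
        using tiling_dist_triangle [of "h (T' \<ominus> 0)" "h (T' \<ominus> x)" "h T"]
        by (simp add: tiling_dist_commute)
      also have "\<dots> < \<delta> / 2"
        using near [OF T', of 0] near [OF T', of x] x d(1) by simp
      finally show "tiling_dist (h (T' \<ominus> 0)) (h (T' \<ominus> x)) < \<delta> / 2" .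
    qed (use \<delta> y d(1) in auto)
    then show ?thesis by simp
  qed
  then show ?thesis using d(1) by (intro exI [of _ "d / 2"]) auto
qed

text \<open>Lying in the orbit of \<open>h T\<close> is a locally constant property of \<open>h (T \<ominus> x)\<close>.\<close>

lemma orbit_to_orbit:
  assumes T: "T \<in> \<Omega>"
  shows "\<exists>v. h (T \<ominus> x) = h T \<ominus> v"
proof -
  define \<delta> where "\<delta> = min 1 (\<eta> / 4)"
  have \<delta>: "0 < \<delta>" "\<delta> \<le> 1" "3 * \<delta> < \<eta>"
    using inradius by (auto simp: \<delta>_def inradius_bound_def)
  have "(\<exists>v. h (T \<ominus> 0) = h T \<ominus> v) = (\<exists>v. h (T \<ominus> x) = h T \<ominus> v)"
  proof (rule connected_local_const [OF connected_UNIV UNIV_I UNIV_I,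
        of "\<lambda>x. \<exists>v. h (T \<ominus> x) = h T \<ominus> v"], rule ballI)
    fix y
    obtain d where d: "d > 0"
        "\<And>z. norm z < d \<Longrightarrow> \<exists>v. h ((T \<ominus> y) \<ominus> z) = h (T \<ominus> y) \<ominus> v"
      using small_translates_small_displacements [OF shift_closed [OF T, of y] \<delta>]
        shift_closed [OF T, of y] by (metis tiling_dist_refl)
    have "\<forall>\<^sub>F z in at y. dist z y < d"
      using d(1) by (auto simp: eventually_at)
    then show "\<forall>\<^sub>F z in at y. (\<exists>v. h (T \<ominus> y) = h T \<ominus> v) = (\<exists>v. h (T \<ominus> z) = h T \<ominus> v)"
    proof eventually_elim
      case (elim z)
      then obtain v where "h ((T \<ominus> y) \<ominus> (z - y)) = h (T \<ominus> y) \<ominus> v"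
        using d(2) [of "z - y"] by (auto simp: dist_norm)
      then have v: "h (T \<ominus> z) = h (T \<ominus> y) \<ominus> v" by (simp add: shift_shift)
      then have "h (T \<ominus> y) = h (T \<ominus> z) \<ominus> (- v)" by (simp add: shift_shift)
      with v show ?case by (metis shift_shift)
    qed
  qed
  then show ?thesis by (metis shift_0)
qed

lemma orbit_vector_unique:
  assumes "S \<in> \<Omega>'" "S \<ominus> v = S \<ominus> v'"
  shows "v = v'"
proof -
  have "(S \<ominus> v) \<ominus> (- v') = (S \<ominus> v') \<ominus> (- v')" using assms(2) by simp
  then have "S \<ominus> (v - v') = S" by (simp add: shift_shift)
  then show ?thesis
    using codomain_aperiodic [OF assms(1)] unfolding aperiodic_def by (metis right_minus_eq)
qed

lemma orbit_map_eqI: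
  assumes "T \<in> \<Omega>" "h (T \<ominus> x) = h T \<ominus> v"
  shows "orbit_map h T x = v"
  unfolding orbit_map_def using assms orbit_vector_unique [OF maps_to [OF assms(1)]]
  by (intro the_equality) auto

lemma h_shift:
  assumes "T \<in> \<Omega>"
  shows "h (T \<ominus> x) = h T \<ominus> orbit_map h T x"
  using orbit_to_orbit [OF assms, of x] orbit_map_eqI [OF assms, of x] by auto

lemma orbit_map_add:
  assumes "T \<in> \<Omega>"
  shows "orbit_map h T (x + y) = orbit_map h T x + orbit_map h (T \<ominus> x) y"
  using h_shift [OF assms, of x] h_shift [OF shift_closed [OF assms, of x], of y]
  by (intro orbit_map_eqI assms) (simp add: shift_shift)

text \<open>Sequential continuity of the orbit map at a pair; sequences make the cocycle identity
  usable through the rules for limits of sums.\<close>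

definition jointly_continuous_at :: "('n, 'l) tiling \<Rightarrow> real ^ 'n \<Rightarrow> bool" where
  "jointly_continuous_at T x \<longleftrightarrow>
     (\<forall>f g. (\<forall>n. f n \<in> \<Omega>) \<longrightarrow> (\<lambda>n. tiling_dist T (f n)) \<longlonglongrightarrow> 0 \<longrightarrow> g \<longlonglongrightarrow> x \<longrightarrow>
        (\<lambda>n. orbit_map h (f n) (g n)) \<longlonglongrightarrow> orbit_map h T x)"

lemma jointly_continuous_atD:
  assumes "jointly_continuous_at T x" "\<And>n. f n \<in> \<Omega>" "(\<lambda>n. tiling_dist T (f n)) \<longlonglongrightarrow> 0" "g \<longlonglongrightarrow> x"
  shows "(\<lambda>n. orbit_map h (f n) (g n)) \<longlonglongrightarrow> orbit_map h T x"
  using assms unfolding jointly_continuous_at_def by blast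

text \<open>For small \<open>x\<close> all vectors in question are smaller than a fixed fraction of \<open>\<eta>\<close>, so that
  \<open>nearby_displacements\<close> applies with \<open>\<epsilon>\<close> of the order of the required accuracy.\<close>

lemma jointly_continuous_near_0:
  assumes T: "T \<in> \<Omega>"
  shows "\<exists>d>0. \<forall>x. norm x < d \<longrightarrow> jointly_continuous_at T x"
proof -
  define \<delta> where "\<delta> = min 1 (\<eta> / 6)"
  have "\<eta> > 0" using inradius by (simp add: inradius_bound_def)
  then have \<delta>: "0 < \<delta>" "\<delta> \<le> 1" "3 * \<delta> < \<eta>" "\<delta> \<le> \<eta> / 6"
    by (auto simp: \<delta>_def)
  obtain d where "d > 0" and d: "\<And>T' y. \<lbrakk>T' \<in> \<Omega>; tiling_dist T T' < d; norm y < d\<rbrakk> \<Longrightarrow>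
      norm (orbit_map h T' y) \<le> \<delta>"
    using small_translates_small_displacements [OF T \<delta>(1-3)] by (metis orbit_map_eqI)
  have "jointly_continuous_at T x" if x: "norm x < d" for x
    unfolding jointly_continuous_at_def
  proof (intro allI impI tendstoI)
    fix f :: "nat \<Rightarrow> ('n, 'l) tiling" and g and e :: real
    assume f: "\<forall>n. f n \<in> \<Omega>" "(\<lambda>n. tiling_dist T (f n)) \<longlonglongrightarrow> 0" and g: "g \<longlonglongrightarrow> x" and "e > 0"
    define \<epsilon> where "\<epsilon> = min (1 / 2) (min (\<eta> / 4) (e / 4))"
    have \<epsilon>: "0 < \<epsilon>" "\<epsilon> \<le> 1 / 2" "\<epsilon> \<le> \<eta> / 4" "\<epsilon> \<le> e / 4"
      using \<open>\<eta> > 0\<close> \<open>e > 0\<close> by (auto simp: \<epsilon>_def)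
    have "1 < 1 / \<epsilon>" using \<epsilon> by simp
    have "(\<lambda>n. tiling_dist (h T) (h (f n))) \<longlonglongrightarrow> 0"
      using h_tendsto [OF T _ f(2)] f(1) by blast
    then have "\<forall>\<^sub>F n in sequentially. tiling_dist (h T) (h (f n)) < \<epsilon> / 2"
      using order_tendstoD(2) \<epsilon>(1) half_gt_zero by blast
    moreover have "(\<lambda>n. tiling_dist (h (T \<ominus> x)) (h (f n \<ominus> g n))) \<longlonglongrightarrow> 0"
      using f g T by (intro h_tendsto tiling_dist_shift_tendsto shift_closed) auto
    then have "\<forall>\<^sub>F n in sequentially. tiling_dist (h (T \<ominus> x)) (h (f n \<ominus> g n)) < \<epsilon> / 2"
      using order_tendstoD(2) \<epsilon>(1) half_gt_zero by blast
    moreover have "\<forall>\<^sub>F n in sequentially. tiling_dist T (f n) < d"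
      using order_tendstoD(2) [OF f(2) \<open>d > 0\<close>] .
    moreover have "\<forall>\<^sub>F n in sequentially. norm (g n) < d"
      using order_tendstoD(2) [OF tendsto_norm [OF g] x] .
    ultimately show "\<forall>\<^sub>F n in sequentially. dist (orbit_map h (f n) (g n)) (orbit_map h T x) < e"
    proof eventually_elim
      case (elim n)
      have fn: "f n \<in> \<Omega>" using f(1) by blast
      have small: "norm (orbit_map h T x) \<le> \<delta>" "norm (orbit_map h (f n) (g n)) \<le> \<delta>"
        using d [OF T _ x] d [OF fn elim(3,4)] \<open>d > 0\<close> by auto
      have "norm (orbit_map h (f n) (g n) - orbit_map h T x) \<le> 2 * \<epsilon>"
      proof (rule nearby_displacements [OF inradius h_tilings [OF T] h_tilings [OF fn] elim(1)])
        show "tiling_dist (h T \<ominus> orbit_map h T x) (h (f n) \<ominus> orbit_map h (f n) (g n)) < \<epsilon> / 2"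
          using elim(2) h_shift T fn by simp
        show "norm (orbit_map h T x) < 1 / \<epsilon>" using small \<delta> \<open>1 < 1 / \<epsilon>\<close> by linarith
        show "norm (orbit_map h (f n) (g n) - orbit_map h T x) + 2 * \<epsilon> < \<eta>"
          using small \<delta> \<epsilon> \<open>\<eta> > 0\<close>
            norm_triangle_ineq4 [of "orbit_map h (f n) (g n)" "orbit_map h T x"] by linarith
      qed (use \<epsilon> in simp)
      then show ?case using \<epsilon> \<open>e > 0\<close> by (simp add: dist_norm)
    qed
  qed
  with \<open>d > 0\<close> show ?thesis by blast
qed

text \<open>By the cocycle identity, the orbit maps at \<open>x\<close> and at \<open>x + z\<close> differ by a term that is
  continuous by assumption. In the backward direction it is the base point \<open>f n \<ominus> g n\<close> of this
  term that varies.\<close>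

lemma jointly_continuous_step:
  assumes T: "T \<in> \<Omega>" and z: "jointly_continuous_at (T \<ominus> x) z"
  shows "jointly_continuous_at T x \<longleftrightarrow> jointly_continuous_at T (x + z)"
proof
  assume x: "jointly_continuous_at T x"
  show "jointly_continuous_at T (x + z)"
    unfolding jointly_continuous_at_def
  proof (intro allI impI)
    fix f :: "nat \<Rightarrow> ('n, 'l) tiling" and g
    assume f: "\<forall>n. f n \<in> \<Omega>" "(\<lambda>n. tiling_dist T (f n)) \<longlonglongrightarrow> 0" and g: "g \<longlonglongrightarrow> x + z"
    have "(\<lambda>n. g n - x) \<longlonglongrightarrow> z" using tendsto_diff [OF g tendsto_const [of x]] by simp
    then have "(\<lambda>n. orbit_map h (f n) x + orbit_map h (f n \<ominus> x) (g n - x))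
        \<longlonglongrightarrow> orbit_map h T x + orbit_map h (T \<ominus> x) z"
      using f by (intro tendsto_add jointly_continuous_atD [OF x] jointly_continuous_atD [OF z]
          tiling_dist_shift_tendsto shift_closed) auto
    moreover have "orbit_map h (f n) (g n) = orbit_map h (f n) x + orbit_map h (f n \<ominus> x) (g n - x)" for n
      using orbit_map_add [of "f n" x "g n - x"] f(1) by simp
    ultimately show "(\<lambda>n. orbit_map h (f n) (g n)) \<longlonglongrightarrow> orbit_map h T (x + z)"
      using orbit_map_add [OF T] by simp
  qed
next
  assume xz: "jointly_continuous_at T (x + z)"
  show "jointly_continuous_at T x"
    unfolding jointly_continuous_at_def
  proof (intro allI impI)
    fix f :: "nat \<Rightarrow> ('n, 'l) tiling" and g
    assume f: "\<forall>n. f n \<in> \<Omega>" "(\<lambda>n. tiling_dist T (f n)) \<longlonglongrightarrow> 0" and g: "g \<longlonglongrightarrow> x"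
    have "(\<lambda>n. orbit_map h (f n) (g n + z) - orbit_map h (f n \<ominus> g n) z)
        \<longlonglongrightarrow> orbit_map h T (x + z) - orbit_map h (T \<ominus> x) z"
      using f g by (intro tendsto_diff tendsto_add tendsto_const jointly_continuous_atD [OF xz]
          jointly_continuous_atD [OF z] tiling_dist_shift_tendsto shift_closed) auto
    moreover have "orbit_map h (f n) (g n) = orbit_map h (f n) (g n + z) - orbit_map h (f n \<ominus> g n) z" for n
      using orbit_map_add [of "f n" "g n" z] f(1) by simp
    ultimately show "(\<lambda>n. orbit_map h (f n) (g n)) \<longlonglongrightarrow> orbit_map h T x"
      using orbit_map_add [OF T] by simp
  qed
qed

lemma jointly_continuous:
  assumes T: "T \<in> \<Omega>"
  shows "jointly_continuous_at T x"
proof -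
  have "jointly_continuous_at T 0 = jointly_continuous_at T x"
  proof (rule connected_local_const [OF connected_UNIV UNIV_I UNIV_I, of "jointly_continuous_at T"], rule ballI)
    fix y
    obtain d where d: "d > 0" "\<And>z. norm z < d \<Longrightarrow> jointly_continuous_at (T \<ominus> y) z"
      using jointly_continuous_near_0 [OF shift_closed [OF T, of y]] by blast
    have "\<forall>\<^sub>F z in at y. dist z y < d"
      using d(1) by (auto simp: eventually_at)
    then show "\<forall>\<^sub>F z in at y. jointly_continuous_at T y = jointly_continuous_at T z"
    proof eventually_elim
      case (elim z)
      then have "jointly_continuous_at (T \<ominus> y) (z - y)" using d(2) by (simp add: dist_norm)
      from jointly_continuous_step [OF T this] show ?case by simp
    qed
  qed
  moreover have "jointly_continuous_at T 0"
    using jointly_continuous_near_0 [OF T] by auto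
  ultimately show ?thesis by simp
qed

lemma continuous_on_orbit_map:
  assumes T: "T \<in> \<Omega>"
  shows "continuous_on UNIV (orbit_map h T)"
  unfolding continuous_on_sequentially
  using jointly_continuous_atD [OF jointly_continuous [OF T], of "\<lambda>_. T"] T
  by (auto simp: o_def)

lemma continuous_map_orbit_map:
  assumes "inradius_bound P \<eta>0" "\<Omega> \<subseteq> tilings P"
  shows "continuous_map (prod_topology (space_topology P \<Omega>) euclidean) euclidean
           (\<lambda>(T, x). orbit_map h T x)"
proof -
  interpret Metric_space "tilings P" tiling_dist
    using Metric_space_tilings [OF assms(1)] .
  have top: "topspace (space_topology P \<Omega>) = \<Omega>"
    using assms(2) by (auto simp: tiling_topology_def)
  have "openin (prod_topology (space_topology P \<Omega>) euclidean)
      {p \<in> \<Omega> \<times> UNIV. (\<lambda>(T, x). orbit_map h T x) p \<in> V}" if "open V" for V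
    unfolding openin_prod_topology_alt
  proof (intro allI impI)
    fix T x assume "(T, x) \<in> {p \<in> \<Omega> \<times> UNIV. (\<lambda>(T, x). orbit_map h T x) p \<in> V}"
    then have T: "T \<in> \<Omega>" and V: "orbit_map h T x \<in> V" by auto
    have "\<exists>d>0. \<forall>T'\<in>\<Omega>. \<forall>y. tiling_dist T T' < d \<longrightarrow> dist x y < d \<longrightarrow> orbit_map h T' y \<in> V"
    proof (rule ccontr)
      assume "\<not> ?thesis"
      then have "\<forall>n. \<exists>T' y. T' \<in> \<Omega> \<and> tiling_dist T T' < inverse (real (Suc n)) \<and>
          dist x y < inverse (real (Suc n)) \<and> orbit_map h T' y \<notin> V"
        by (meson inverse_positive_iff_positive of_nat_0_less_iff zero_less_Suc)
      then obtain f g where fg: "\<And>n. f n \<in> \<Omega>" "\<And>n. tiling_dist T (f n) < inverse (real (Suc n))"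
          "\<And>n. dist x (g n) < inverse (real (Suc n))" "\<And>n. orbit_map h (f n) (g n) \<notin> V"
        by metis
      have "(\<lambda>n. tiling_dist T (f n)) \<longlonglongrightarrow> 0"
        using fg(2) by (intro LIMSEQ_0_if_less_inverse tiling_dist_nonneg)
      moreover have "(\<lambda>n. dist (g n) x) \<longlonglongrightarrow> 0"
        using fg(3) by (intro LIMSEQ_0_if_less_inverse zero_le_dist) (simp add: dist_commute)
      then have "g \<longlonglongrightarrow> x" by (rule tendsto_dist_iff [THEN iffD2])
      ultimately have "(\<lambda>n. orbit_map h (f n) (g n)) \<longlonglongrightarrow> orbit_map h T x"
        by (intro jointly_continuous_atD [OF jointly_continuous [OF T] fg(1)])
      from topological_tendstoD [OF this \<open>open V\<close> V] fg(4) show False by simp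
    qed
    then obtain d where d: "d > 0"
        "\<And>T' y. \<lbrakk>T' \<in> \<Omega>; tiling_dist T T' < d; dist x y < d\<rbrakk> \<Longrightarrow> orbit_map h T' y \<in> V"
      by blast
    show "\<exists>U W. openin (space_topology P \<Omega>) U \<and> openin euclidean W \<and> T \<in> U \<and> x \<in> W \<and>
        U \<times> W \<subseteq> {p \<in> \<Omega> \<times> UNIV. (\<lambda>(T, x). orbit_map h T x) p \<in> V}"
    proof (intro exI [of _ "\<Omega> \<inter> mball T d"] exI [of _ "ball x d"] conjI)
      show "openin (space_topology P \<Omega>) (\<Omega> \<inter> mball T d)"
        unfolding tiling_topology_def by (rule openin_subtopology_Int2) (rule openin_mball)
      show "T \<in> \<Omega> \<inter> mball T d" using T assms(2) d(1) by auto
    qed (use d in auto)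
  qed
  then show ?thesis using top by (simp add: continuous_map_def)
qed

end

section \<open>Hulls\<close>

lemma mem_tiling_hull_iff:
  assumes "inradius_bound P \<eta>" "T \<in> tilings P"
  shows "S \<in> tiling_hull P T \<longleftrightarrow> S \<in> tilings P \<and> (\<forall>e>0. \<exists>x. tiling_dist S (T \<ominus> x) < e)"
proof -
  interpret Metric_space "tilings P" tiling_dist
    using Metric_space_tilings [OF assms(1)] .
  show ?thesis
    using tilings_shift [OF assms(2)]
    by (auto simp: tiling_hull_def tiling_topology_def metric_closure_of)
qed

lemma tiling_hull_shift:
  assumes "inradius_bound P \<eta>" "T \<in> tilings P" "S \<in> tiling_hull P T"
  shows "S \<ominus> y \<in> tiling_hull P T"
proof -
  note hull = mem_tiling_hull_iff [OF assms(1,2)]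
  have "\<forall>n. \<exists>x. tiling_dist S (T \<ominus> x) < inverse (real (Suc n))"
    using assms(3) hull by simp
  then obtain f where f: "\<And>n. tiling_dist S (T \<ominus> f n) < inverse (real (Suc n))" by metis
  have "(\<lambda>n. tiling_dist S (T \<ominus> f n)) \<longlonglongrightarrow> 0"
    using f by (intro LIMSEQ_0_if_less_inverse tiling_dist_nonneg)
  then have lim: "(\<lambda>n. tiling_dist (S \<ominus> y) ((T \<ominus> f n) \<ominus> y)) \<longlonglongrightarrow> 0"
    by (intro tiling_dist_shift_tendsto tendsto_const)
  have "\<exists>x. tiling_dist (S \<ominus> y) (T \<ominus> x) < e" if e: "e > 0" for e
  proof -
    obtain n where "tiling_dist (S \<ominus> y) ((T \<ominus> f n) \<ominus> y) < e"
      using order_tendstoD(2) [OF lim e] by (auto simp: eventually_sequentially)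
    then show ?thesis by (auto simp: shift_shift)
  qed
  then show ?thesis using hull assms(3) tilings_shift by blast
qed

text \<open>Minimality in the form needed here. All large balls of \<open>T\<close> contain a copy of the patch, and an
  element of the hull agrees on a large ball with a translate of \<open>T\<close>.\<close>

lemma repetitive_patch_in_hull:
  assumes "inradius_bound P \<eta>" "T \<in> tilings P" "repetitive T" "S \<in> tiling_hull P T"
    and "finite Q" "Q \<subseteq> T"
  shows "\<exists>v. Q \<ominus> v \<subseteq> S"
proof -
  obtain R where R: "R > 0" "\<And>x. \<exists>v. Q \<ominus> v \<subseteq> patch T x R"
    using assms unfolding repetitive_def by blast
  define \<epsilon> where "\<epsilon> = min 1 (1 / R)"
  have \<epsilon>: "\<epsilon> > 0" "\<epsilon> \<le> 1" "\<epsilon> \<le> 1 / R" using R(1) by (auto simp: \<epsilon>_def)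
  obtain y where "tiling_dist S (T \<ominus> y) < \<epsilon> / 2"
    using assms(4) mem_tiling_hull_iff [OF assms(1,2)] \<epsilon>(1) half_gt_zero by blast
  then obtain w where w: "patch S 0 (1 / \<epsilon>) = patch ((T \<ominus> y) \<ominus> w) 0 (1 / \<epsilon>)"
    using tiling_dist_less_displacement \<epsilon>(2) by blast
  have "R \<le> 1 / \<epsilon>" using \<epsilon> R(1) by (simp add: field_simps)
  then have eq: "patch S 0 R = patch T (y + w) R \<ominus> (y + w)"
    using patch_eq_subball [OF w subset_ball] by (simp add: shift_shift patch_shift)
  obtain v where "Q \<ominus> v \<subseteq> patch T (y + w) R" using R(2) by blast
  then have "(Q \<ominus> v) \<ominus> (y + w) \<subseteq> patch S 0 R"
    unfolding eq by (auto simp: shift_def)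
  then show ?thesis by (auto simp: shift_shift patch_def)
qed

text \<open>A period \<open>x\<close> of \<open>S\<close> is a period of \<open>T\<close>: for a tile \<open>t\<close> of \<open>T\<close>, let \<open>t'\<close> be a tile of \<open>T\<close> that
  overlaps \<open>t - x\<close>. A copy of the two-tile patch \<open>{t, t'}\<close> occurs in \<open>S\<close>, and periodicity of \<open>S\<close> adds
  the copy of \<open>t - x\<close>; since it overlaps the copy of \<open>t'\<close>, the two coincide.\<close>

lemma aperiodic_tiling_hull:
  assumes P: "inradius_bound P \<eta>" and T: "T \<in> tilings P" and "aperiodic T" "repetitive T"
    and S: "S \<in> tiling_hull P T"
  shows "aperiodic S"
proof -
  have "x = 0" if x: "S \<ominus> x = S" for x
  proof -
    have "S \<in> tilings P" using S mem_tiling_hull_iff [OF P T] by blast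
    have "T \<ominus> x \<subseteq> T"
    proof
      fix u assume "u \<in> T \<ominus> x"
      then obtain t where t: "t \<in> T" "u = shift_tile t x" by (auto simp: shift_def)
      have "is_tile t" using t(1) T by (simp add: tilings_def)
      then obtain c where c: "c \<in> interior (fst u)"
        using is_tile_interior_nonempty [of u] t(2) by (auto simp: is_tile_shift_tile)
      obtain t' where t': "t' \<in> T" "c \<in> fst t'" using tilings_cover [OF T] by blast
      then have "is_tile t'" using T by (simp add: tilings_def)
      then have meet: "interior (fst t') \<inter> interior (fst u) \<noteq> {}"
        using tile_through_interior_overlaps t'(2) c by blast
      obtain v where "{t, t'} \<ominus> v \<subseteq> S"
        using repetitive_patch_in_hull [OF P T \<open>repetitive T\<close> S, of "{t, t'}"] t t' by blast
      then have "shift_tile t v \<in> S" "shift_tile t' v \<in> S" by (auto simp: shift_def)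
      then have "shift_tile u v \<in> S" "shift_tile t' v \<in> S"
        using shift_tile_in_shift [of "shift_tile t v" S x] x t(2) by (auto simp: add.commute)
      moreover have "interior (fst (shift_tile t' v)) \<inter> interior (fst (shift_tile u v)) \<noteq> {}"
        using meet by (simp only: interior_shift_tile translation_Int [symmetric] image_is_empty) simp
      ultimately have "shift_tile t' v = shift_tile u v"
        using tilings_overlap_eq [OF \<open>S \<in> tilings P\<close>] by blast
      then have "shift_tile (shift_tile t' v) (- v) = shift_tile (shift_tile u v) (- v)" by simp
      then show "u \<in> T" using t'(1) by simp
    qed
    then have "T \<ominus> x = T" using tilings_subset_imp_eq [OF tilings_shift [OF T] T] by blast
    then show ?thesis using \<open>aperiodic T\<close> by (auto simp: aperiodic_def)
  qed
  then show ?thesis by (auto simp: aperiodic_def)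
qed

lemma aperiodic_minimal_FLC_spaceE:
  assumes "aperiodic_minimal_FLC_space P \<Omega>"
  obtains \<eta> where "inradius_bound P \<eta>" "\<Omega> \<subseteq> tilings P" "\<And>T x. T \<in> \<Omega> \<Longrightarrow> T \<ominus> x \<in> \<Omega>"
    "\<And>T. T \<in> \<Omega> \<Longrightarrow> aperiodic T"
proof -
  obtain \<eta> where \<eta>: "inradius_bound P \<eta>"
    using assms inradius_bound_exists unfolding aperiodic_minimal_FLC_space_def by blast
  obtain T where T: "T \<in> tilings P" "aperiodic T" "repetitive T" "\<Omega> = tiling_hull P T"
    using assms unfolding aperiodic_minimal_FLC_space_def by blast
  show ?thesis
    using that \<eta> T mem_tiling_hull_iff [OF \<eta> T(1)] tiling_hull_shift [OF \<eta> T(1)]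
      aperiodic_tiling_hull [OF \<eta> T(1-3)] by blast
qed

lemma space_topology_eq_mtopology:
  assumes "inradius_bound P \<eta>" "\<Omega> \<subseteq> tilings P"
  shows "Metric_space \<Omega> tiling_dist" "space_topology P \<Omega> = Metric_space.mtopology \<Omega> tiling_dist"
proof -
  interpret Submetric "tilings P" tiling_dist \<Omega>
    using Metric_space_tilings [OF assms(1)] assms(2)
    by (simp add: Submetric_def Submetric_axioms_def)
  show "Metric_space \<Omega> tiling_dist" by (rule sub.Metric_space_axioms)
  show "space_topology P \<Omega> = Metric_space.mtopology \<Omega> tiling_dist"
    by (simp add: tiling_topology_def mtopology_submetric)
qed

lemma tiling_space_mapI:
  assumes P: "aperiodic_minimal_FLC_space P \<Omega>" and P': "aperiodic_minimal_FLC_space P' \<Omega>'"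
    and h: "continuous_map (space_topology P \<Omega>) (space_topology P' \<Omega>') h"
  shows "\<exists>\<eta>. tiling_space_map \<Omega> P' \<Omega>' h \<eta>"
proof -
  obtain \<eta> where \<eta>: "inradius_bound P \<eta>" "\<Omega> \<subseteq> tilings P" "\<And>T x. T \<in> \<Omega> \<Longrightarrow> T \<ominus> x \<in> \<Omega>"
    using aperiodic_minimal_FLC_spaceE [OF P] by metis
  obtain \<eta>' where \<eta>': "inradius_bound P' \<eta>'" "\<Omega>' \<subseteq> tilings P'" "\<And>T. T \<in> \<Omega>' \<Longrightarrow> aperiodic T"
    using aperiodic_minimal_FLC_spaceE [OF P'] by metis
  note top = space_topology_eq_mtopology [OF \<eta>(1,2)] and top' = space_topology_eq_mtopology [OF \<eta>'(1,2)]
  have maps: "h ` \<Omega> \<subseteq> \<Omega>'" and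
    cont: "\<forall>T\<in>\<Omega>. \<forall>e>0. \<exists>d>0. \<forall>T'. T' \<in> \<Omega> \<and> tiling_dist T T' < d \<longrightarrow>
      tiling_dist (h T) (h T') < e"
    using h Metric_space.metric_continuous_map [OF top(1) top'(1), of h]
    unfolding top(2) top'(2) by simp_all
  have "tiling_space_map \<Omega> P' \<Omega>' h \<eta>'"
  proof
    show "h T \<in> \<Omega>'" if "T \<in> \<Omega>" for T using maps that by blast
    show "\<exists>d>0. \<forall>T'\<in>\<Omega>. tiling_dist T T' < d \<longrightarrow> tiling_dist (h T) (h T') < e"
      if "T \<in> \<Omega>" "e > 0" for T e
      using cont [rule_format, OF that] by blast
  qed (fact \<eta> \<eta>')+
  then show ?thesis ..
qed

theorem theorem3p10:
  fixes P :: "('n::finite, 'l) tile set set"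
    and P' :: "('n, 'm) tile set set"
    and \<Omega> :: "('n, 'l) tiling set"
    and \<Omega>' :: "('n, 'm) tiling set"
    and h :: "('n, 'l) tiling \<Rightarrow> ('n, 'm) tiling"
  assumes "aperiodic_minimal_FLC_space P \<Omega>"
    and "aperiodic_minimal_FLC_space P' \<Omega>'"
    and "homeomorphic_map (space_topology P \<Omega>) (space_topology P' \<Omega>') h"
  shows "continuous_map (prod_topology (space_topology P \<Omega>) euclidean) euclidean
           (\<lambda>(T, x). orbit_map h T x) \<and>
         (\<forall>T\<in>\<Omega>. homeomorphic_map euclidean euclidean (orbit_map h T) \<and>
                inv (orbit_map h T) = orbit_map (inv_into \<Omega> h) (h T))"
proof -
  let ?k = "inv_into \<Omega> h"
  obtain \<eta>0 where \<eta>0: "inradius_bound P \<eta>0" "\<Omega> \<subseteq> tilings P"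
    using aperiodic_minimal_FLC_spaceE [OF assms(1)] by metis
  have tops: "topspace (space_topology P \<Omega>) = \<Omega>" "topspace (space_topology P' \<Omega>') = \<Omega>'"
    using aperiodic_minimal_FLC_spaceE [OF assms(1)] aperiodic_minimal_FLC_spaceE [OF assms(2)]
      space_topology_eq_mtopology Metric_space.topspace_mtopology by metis+
  have bij: "inj_on h \<Omega>" "h ` \<Omega> = \<Omega>'"
    using homeomorphic_imp_injective_map [OF assms(3)] homeomorphic_imp_surjective_map [OF assms(3)]
    by (simp_all only: tops)
  obtain g where g: "homeomorphic_maps (space_topology P \<Omega>) (space_topology P' \<Omega>') h g"
    using assms(3) homeomorphic_map_maps by blast
  have "g S = ?k S" if S: "S \<in> \<Omega>'" for S
  proof -
    obtain T where T: "T \<in> \<Omega>" "S = h T" using S bij(2) by blast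
    then have "g S = T" using g tops by (auto simp: homeomorphic_maps_def)
    then show ?thesis using T bij(1) by simp
  qed
  then have k: "continuous_map (space_topology P' \<Omega>') (space_topology P \<Omega>) ?k"
    using g tops continuous_map_eq unfolding homeomorphic_maps_def by metis
  obtain \<eta> where "tiling_space_map \<Omega> P' \<Omega>' h \<eta>"
    using tiling_space_mapI [OF assms(1,2) homeomorphic_imp_continuous_map [OF assms(3)]] by blast
  then interpret h: tiling_space_map \<Omega> P' \<Omega>' h \<eta> .
  obtain \<eta>' where "tiling_space_map \<Omega>' P \<Omega> ?k \<eta>'"
    using tiling_space_mapI [OF assms(2,1) k] by blast
  then interpret k: tiling_space_map \<Omega>' P \<Omega> ?k \<eta>' .
  have "homeomorphic_map euclidean euclidean (orbit_map h T) \<and>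
      inv (orbit_map h T) = orbit_map ?k (h T)" if T: "T \<in> \<Omega>" for T
  proof -
    have kh: "?k (h S) = S" if "S \<in> \<Omega>" for S using that bij(1) by simp
    have hk: "h (?k S) = S" if "S \<in> \<Omega>'" for S using that bij(2) by (simp add: f_inv_into_f)
    have left: "orbit_map ?k (h T) (orbit_map h T x) = x" for x
    proof (rule k.orbit_map_eqI [OF h.maps_to [OF T]])
      show "?k (h T \<ominus> orbit_map h T x) = ?k (h T) \<ominus> x"
        using h.h_shift [OF T, of x] kh T h.shift_closed by metis
    qed
    have right: "orbit_map h T (orbit_map ?k (h T) y) = y" for y
    proof (rule h.orbit_map_eqI [OF T])
      show "h (T \<ominus> orbit_map ?k (h T) y) = h T \<ominus> y"
        using k.h_shift [OF h.maps_to [OF T], of y] kh [OF T] hk k.shift_closed h.maps_to [OF T] by metis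
    qed
    have "homeomorphic_maps euclidean euclidean (orbit_map h T) (orbit_map ?k (h T))"
      using h.continuous_on_orbit_map [OF T] k.continuous_on_orbit_map [OF h.maps_to [OF T]] left right
      by (simp add: homeomorphic_maps_def)
    moreover have "inv (orbit_map h T) = orbit_map ?k (h T)"
      using left right by (intro inv_unique_comp) (auto simp: fun_eq_iff)
    ultimately show ?thesis using homeomorphic_maps_map by blast
  qed
  with h.continuous_map_orbit_map [OF \<eta>0] show ?thesis by blast
qed

end
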